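(* Let $(\alpha_n)_{n\in\mathbb{N}}$ be a sequence with $0\le\alpha_n\le\frac1n$ (so $\alpha_n\to0$ as $n\to\infty$). Let $g\in C_w^k[0,\infty)$ and $l>0$. Then $$\lim_{n\to\infty}\ \sup_{x\ge0}\frac{\left|\mathcal{U}_{n}^{[\alpha_n]}(g;x)-g(x)\right|}{(1+x^2)^{1+l}}=0.$$
   Context: For $n\in\mathbb{N}$, $0\le\alpha\le\frac1n$, $x\ge 0$ and a function $f$ on $[0,\infty)$ for which the expression converges absolutely, define $$\mathcal{U}_{n}^{[\alpha]}(f;x)=n\sum_{i=0}^{\infty}(1+n\alpha)^{-x/\alpha}\Big(\alpha+\frac1n\Big)^{-i}\frac{x^{(i,-\alpha)}}{i!}\int_0^\infty e^{-nu}\frac{(nu)^i}{i!}f(u)\,du,$$ with $x^{(0,-\alpha)}=1$ and $x^{(i,-\alpha)}=x(x+\alpha)\cdots(x+(i-1)\alpha)$; for $\alpha=0$ the coefficient is understood as its limit as $\alpha\to0$, namely $e^{-nx}\frac{(nx)^i}{i!}$. Let $w(x)=1+x^2$. $B_w[0,\infty)$ is the set of $f:[0,\infty)\to\mathbb{R}$ with $|f(x)|\le M w(x)$ for all $x\ge0$, for some constant $M>0$ depending on $f$. $C_w[0,\infty)$ is the set of continuous $f\in B_w[0,\infty)$, and $C_w^k[0,\infty)$ is the set of $f\in C_w[0,\infty)$ for which $\lim_{x\to\infty}\frac{|f(x)|}{w(x)}=k_f$ exists and is finite. *)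

theory Defs
  imports "HOL-Analysis.Analysis" "HOL-Real_Asymp.Real_Asymp"
begin

text \<open>
  Functions on \<open>[0, \<infinity>)\<close> are represented by total functions \<^typ>\<open>real \<Rightarrow> real\<close>;
  everything below depends only on their values on \<^term>\<open>{0::real..}\<close>.
\<close>

definition rising :: "real \<Rightarrow> real \<Rightarrow> nat \<Rightarrow> real" where
  "rising \<alpha> x i = (\<Prod>j<i. x + real j * \<alpha>)"

text \<open>
  At \<open>\<alpha> = 0\<close> the general formula would contain \<open>x / 0\<close>, so the limit value is put in explicitly;
  it is justified by \<open>weight_coeff_tendsto\<close> below.
\<close>

definition weight_coeff :: "nat \<Rightarrow> real \<Rightarrow> real \<Rightarrow> nat \<Rightarrow> real" where
  "weight_coeff n \<alpha> x i =
     (if \<alpha> = 0 then exp (- (real n * x)) * (real n * x) ^ i / fact i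
      else (1 + real n * \<alpha>) powr (- x / \<alpha>) * (\<alpha> + 1 / real n) powi (- int i)
             * (rising \<alpha> x i / fact i))"

text \<open>
  Intended for \<open>n \<ge> 1\<close>, \<open>\<alpha> \<ge> 0\<close>, \<open>x \<ge> 0\<close> and \<open>f\<close> for which the expression converges absolutely (in
  particular all members of \<open>C_w\<close> below when \<open>\<alpha> \<le> 1 / n\<close>); otherwise the value is irrelevant.
\<close>

definition U_op :: "nat \<Rightarrow> real \<Rightarrow> (real \<Rightarrow> real) \<Rightarrow> real \<Rightarrow> real" where
  "U_op n \<alpha> f x =
     real n * (\<Sum>i. weight_coeff n \<alpha> x i *
       (LBINT u:{0..}. exp (- (real n * u)) * ((real n * u) ^ i / fact i) * f u))"

definition w :: "real \<Rightarrow> real" where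
  "w x = 1 + x\<^sup>2"

definition B_w :: "(real \<Rightarrow> real) set" where
  "B_w = {f. \<exists>M>0. \<forall>x\<ge>0. \<bar>f x\<bar> \<le> M * w x}"

definition C_w :: "(real \<Rightarrow> real) set" where
  "C_w = {f \<in> B_w. continuous_on {0..} f}"

definition C_w_k :: "(real \<Rightarrow> real) set" where
  "C_w_k = {f \<in> C_w. \<exists>k. ((\<lambda>x. \<bar>f x\<bar> / w x) \<longlongrightarrow> k) at_top}"

lemma weight_coeff_tendsto:
  assumes "n \<ge> 1" "x \<ge> 0"
  shows "((\<lambda>\<alpha>. weight_coeff n \<alpha> x i) \<longlongrightarrow> weight_coeff n 0 x i) (at_right 0)"
proof -
  define N where "N = real n"
  have N: "N > 0" using assms by (simp add: N_def)
  have L: "((\<lambda>\<alpha>. ln (1 + N * \<alpha>) / \<alpha>) \<longlongrightarrow> N) (at_right 0)"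
    using N by real_asymp
  have "((\<lambda>\<alpha>. exp (- x * (ln (1 + N * \<alpha>) / \<alpha>))) \<longlongrightarrow> exp (- x * N)) (at_right 0)"
    by (intro tendsto_intros L)
  moreover have "\<forall>\<^sub>F \<alpha> in at_right 0.
      exp (- x * (ln (1 + N * \<alpha>) / \<alpha>)) = (1 + N * \<alpha>) powr (- x / \<alpha>)"
    using eventually_at_right_less[of 0]
  proof eventually_elim
    case (elim \<alpha>)
    have "1 + N * \<alpha> > 0" using N elim by (simp add: add_pos_pos)
    then show ?case by (simp add: powr_def)
  qed
  ultimately have 1: "((\<lambda>\<alpha>. (1 + N * \<alpha>) powr (- x / \<alpha>)) \<longlongrightarrow> exp (- x * N)) (at_right 0)"
    by (rule Lim_transform_eventually)
  have 2: "((\<lambda>\<alpha>. (\<alpha> + 1 / N) powi (- int i)) \<longlongrightarrow> (0 + 1 / N) powi (- int i)) (at_right 0)"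
    using N by (intro tendsto_intros) auto
  have 3: "((\<lambda>\<alpha>. rising \<alpha> x i / fact i) \<longlongrightarrow> (\<Prod>j<i. x + real j * 0) / fact i) (at_right 0)"
    unfolding rising_def by (intro tendsto_intros) auto
  have "((\<lambda>\<alpha>. (1 + N * \<alpha>) powr (- x / \<alpha>) * (\<alpha> + 1 / N) powi (- int i) * (rising \<alpha> x i / fact i))
      \<longlongrightarrow> exp (- x * N) * (0 + 1 / N) powi (- int i) * ((\<Prod>j<i. x + real j * 0) / fact i)) (at_right 0)"
    by (intro tendsto_mult 1 2 3)
  also have "exp (- x * N) * (0 + 1 / N) powi (- int i) * ((\<Prod>j<i. x + real j * 0) / fact i)
      = weight_coeff n 0 x i"
    using N by (simp add: weight_coeff_def N_def [symmetric] power_int_minus power_int_divide_distrib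
        power_mult_distrib mult.commute field_simps)
  finally show ?thesis
  proof (rule Lim_transform_eventually)
    show "\<forall>\<^sub>F \<alpha> in at_right 0. (1 + N * \<alpha>) powr (- x / \<alpha>) * (\<alpha> + 1 / N) powi (- int i)
        * (rising \<alpha> x i / fact i) = weight_coeff n \<alpha> x i"
      using eventually_at_right_less[of 0]
      by eventually_elim (simp add: weight_coeff_def N_def)
  qed
qed

end

theory Submission
  imports Defs "HOL-Probability.Distributions"
begin

text \<open>
  \<open>U_op n \<alpha> _ x\<close> averages \<open>f\<close> against a mixture of Erlang densities with (negative binomial or Poisson)
  weights; its mean is \<open>x + 1/n\<close> and its second moment about \<open>x\<close> is \<open>\<alpha> x + 2 x/n + 2/n\<^sup>2\<close>. Hence a bound
  \<open>\<bar>g u - g x\<bar> \<le> a + C (u - x)\<^sup>2\<close> passes to \<open>\<bar>U_op n \<alpha> g x - g x\<bar> \<le> a + C (\<alpha> x + 2 x/n + 2/n\<^sup>2)\<close>. On \<open>[0, A]\<close> this is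
  used with small \<open>a\<close>, by uniform continuity; for \<open>x > A\<close> the growth condition gives it with \<open>a\<close> of
  order \<open>1 + x\<^sup>2\<close>, and the factor \<open>(1 + x\<^sup>2) powr l\<close> makes the quotient small for large \<open>A\<close>.
\<close>

section \<open>Total mass and factorial moments of the weights\<close>

lemma rising_eq_pochhammer:
  assumes "\<alpha> \<noteq> 0"
  shows "rising \<alpha> x i = \<alpha> ^ i * pochhammer (x / \<alpha>) i"
proof -
  have "rising \<alpha> x i = (\<Prod>j<i. \<alpha> * (x / \<alpha> + real j))"
    unfolding rising_def using assms by (intro prod.cong) (auto simp: field_simps)
  also have "\<dots> = \<alpha> ^ i * (\<Prod>j<i. x / \<alpha> + real j)"
    by (simp add: prod.distrib)
  finally show ?thesis
    by (simp add: pochhammer_prod atLeast0LessThan)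
qed

lemma rising_Suc_shift: "rising \<alpha> x (Suc i) = x * rising \<alpha> (x + \<alpha>) i"
  unfolding rising_def by (subst prod.lessThan_Suc_shift) (simp add: algebra_simps)

lemma weight_coeff_nonneg:
  assumes "\<alpha> \<ge> 0" "x \<ge> 0"
  shows "weight_coeff n \<alpha> x i \<ge> 0"
  unfolding weight_coeff_def rising_def using assms
  by (auto intro!: mult_nonneg_nonneg divide_nonneg_nonneg prod_nonneg)

text \<open>For \<open>\<alpha> = 0\<close> this is the exponential series. For
  \<open>\<alpha> > 0\<close> it is the generalized binomial series with exponent
  \<open>- x / \<alpha>\<close>, whose value cancels the leading power of
  \<open>1 + n * \<alpha>\<close>.\<close>

lemma sums_weight_coeff:
  assumes "n \<ge> 1" "\<alpha> \<ge> 0"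
  shows "(\<lambda>i. weight_coeff n \<alpha> x i) sums 1"
proof (cases "\<alpha> = 0")
  case True
  have "(\<lambda>i. exp (- (real n * x)) * ((real n * x) ^ i /\<^sub>R fact i)) sums
      (exp (- (real n * x)) * exp (real n * x))"
    by (intro sums_mult exp_converges)
  then show ?thesis
    using True by (simp add: weight_coeff_def divide_inverse mult_ac flip: exp_add)
next
  case False
  then have a: "\<alpha> > 0" using assms by simp
  define N where "N = real n"
  have N: "N > 0" using assms by (simp add: N_def)
  have p: "1 + N * \<alpha> > 0" using N a by (simp add: add_pos_pos)
  \<comment> \<open>Up to sign this is \<open>\<alpha> / (\<alpha> + 1 / N)\<close>, the ratio
    hidden in the weights; \<open>1 + z\<close> is then the inverse of
    \<open>1 + N * \<alpha>\<close>.\<close>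
  define z where "z = - (N * \<alpha> / (1 + N * \<alpha>))"
  have z: "\<bar>z\<bar> < 1" "1 + z = inverse (1 + N * \<alpha>)"
    using N a p by (auto simp: z_def field_simps abs_mult)
  have "(\<lambda>i. ((- x / \<alpha>) gchoose i) * z ^ i) sums (1 + z) powr (- x / \<alpha>)"
    using z(1) by (rule gen_binomial_real)
  then have "(\<lambda>i. (1 + N * \<alpha>) powr (- x / \<alpha>) * (((- x / \<alpha>) gchoose i) * z ^ i)) sums
      ((1 + N * \<alpha>) powr (- x / \<alpha>) * (1 + z) powr (- x / \<alpha>))"
    by (rule sums_mult)
  also have "(1 + N * \<alpha>) powr (- x / \<alpha>) * (1 + z) powr (- x / \<alpha>) = 1"
    using p z(2) by (simp flip: powr_mult)
  also have "(\<lambda>i. (1 + N * \<alpha>) powr (- x / \<alpha>) * (((- x / \<alpha>) gchoose i) * z ^ i)) =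
      (\<lambda>i. weight_coeff n \<alpha> x i)"
  proof
    fix i
    have z': "z = (- 1) * (inverse (\<alpha> + 1 / N) * \<alpha>)"
      using N p by (simp add: z_def field_simps)
    \<comment> \<open>One factor \<open>(-1) ^ i\<close> comes from the negative upper argument of
      the binomial coefficient, the other from \<open>z\<close>; they cancel.\<close>
    have "((- x / \<alpha>) gchoose i) * z ^ i =
        ((-1) ^ i * (-1) ^ i) * (inverse (\<alpha> + 1 / N) ^ i * (\<alpha> ^ i * pochhammer (x / \<alpha>) i / fact i))"
      unfolding z' power_mult_distrib gbinomial_pochhammer by simp
    also have "(-1) ^ i * (-1) ^ i = (1::real)"
      by (simp flip: power_mult_distrib)
    finally show "(1 + N * \<alpha>) powr (- x / \<alpha>) * (((- x / \<alpha>) gchoose i) * z ^ i) = weight_coeff n \<alpha> x i"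
      using False
      by (simp add: weight_coeff_def N_def rising_eq_pochhammer power_int_minus power_inverse)
  qed
  finally show ?thesis .
qed

text \<open>Size biasing: the factor \<open>i + 1\<close> cancels against the factorial, and the
  first factor \<open>x\<close> of the rising product splits off. What remains is the product
  started at \<open>x + \<alpha>\<close>, and the spare factor \<open>n / (1 + n * \<alpha>)\<close>
  is just what that shift does to the exponent \<open>- x / \<alpha>\<close>. Each use lowers the
  order of a factorial moment by one.\<close>

lemma Suc_weight_coeff:
  assumes "n \<ge> 1" "\<alpha> \<ge> 0"
  shows "real (Suc i) * weight_coeff n \<alpha> x (Suc i) = real n * x * weight_coeff n \<alpha> (x + \<alpha>) i"
proof (cases "\<alpha> = 0")
  case True
  then show ?thesis by (simp add: weight_coeff_def field_simps del: of_nat_Suc)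
next
  case False
  define N where "N = real n"
  have N: "N > 0" using assms by (simp add: N_def)
  have p: "1 + N * \<alpha> > 0" using N assms by (simp add: add_pos_nonneg)
  have "- (x + \<alpha>) / \<alpha> = - x / \<alpha> - 1"
    using False by (simp add: field_simps)
  then have 1: "(1 + N * \<alpha>) powr (- (x + \<alpha>) / \<alpha>) = (1 + N * \<alpha>) powr (- x / \<alpha>) / (1 + N * \<alpha>)"
    using p by (simp add: powr_diff)
  have 2: "(\<alpha> + 1 / N) powi (- int (Suc i)) = (\<alpha> + 1 / N) powi (- int i) * (N / (1 + N * \<alpha>))"
    unfolding power_int_minus power_int_of_nat using N p by (simp add: field_simps)
  have 3: "real (Suc i) * (rising \<alpha> x (Suc i) / fact (Suc i)) = x * (rising \<alpha> (x + \<alpha>) i / fact i)"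
    unfolding rising_Suc_shift fact_Suc by (simp del: of_nat_Suc)
  have "real (Suc i) * weight_coeff n \<alpha> x (Suc i) =
      (1 + N * \<alpha>) powr (- x / \<alpha>) * (\<alpha> + 1 / N) powi (- int (Suc i)) *
        (real (Suc i) * (rising \<alpha> x (Suc i) / fact (Suc i)))"
    using False by (simp add: weight_coeff_def N_def del: of_nat_Suc)
  also have "\<dots> = N * x * ((1 + N * \<alpha>) powr (- (x + \<alpha>) / \<alpha>) * (\<alpha> + 1 / N) powi (- int i) *
        (rising \<alpha> (x + \<alpha>) i / fact i))"
    unfolding 1 2 3 by (simp add: mult_ac)
  also have "\<dots> = real n * x * weight_coeff n \<alpha> (x + \<alpha>) i"
    using False by (simp add: weight_coeff_def N_def)
  finally show ?thesis .
qed

lemma sums_weight_coeff_first_moment: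
  assumes "n \<ge> 1" "\<alpha> \<ge> 0"
  shows "(\<lambda>i. real i * weight_coeff n \<alpha> x i) sums (real n * x)"
proof -
  have "(\<lambda>i. real (Suc i) * weight_coeff n \<alpha> x (Suc i)) sums (real n * x * 1)"
    unfolding Suc_weight_coeff[OF assms] by (intro sums_mult sums_weight_coeff assms)
  \<comment> \<open>The term at index 0 vanishes because of the factor \<open>real i\<close>, so
    shifting the index costs nothing.\<close>
  then show ?thesis
    by (subst (asm) sums_Suc_iff) simp
qed

lemma sums_weight_coeff_second_factorial_moment:
  assumes "n \<ge> 1" "\<alpha> \<ge> 0"
  shows "(\<lambda>i. real i * (real i - 1) * weight_coeff n \<alpha> x i) sums ((real n)\<^sup>2 * x * (x + \<alpha>))"
proof -
  have "(\<lambda>i. real n * x * (real i * weight_coeff n \<alpha> (x + \<alpha>) i)) sums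
      (real n * x * (real n * (x + \<alpha>)))"
    by (intro sums_mult sums_weight_coeff_first_moment assms)
  also have "(\<lambda>i. real n * x * (real i * weight_coeff n \<alpha> (x + \<alpha>) i)) =
      (\<lambda>i. real (Suc i) * (real (Suc i) - 1) * weight_coeff n \<alpha> x (Suc i))"
  proof
    fix i
    show "real n * x * (real i * weight_coeff n \<alpha> (x + \<alpha>) i) =
        real (Suc i) * (real (Suc i) - 1) * weight_coeff n \<alpha> x (Suc i)"
      \<comment> \<open>Since \<open>real i = real (Suc i) - 1\<close>, size biasing reduces the
        second factorial moment at \<open>x\<close> to the first moment at
        \<open>x + \<alpha>\<close>.\<close>
      using arg_cong[OF Suc_weight_coeff[OF assms, of i x, symmetric], of "(*) (real i)"]
      by (simp add: mult_ac)
  qed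
  finally show ?thesis
    by (subst (asm) sums_Suc_iff) (simp add: power2_eq_square mult_ac)
qed

section \<open>Moments of the Erlang densities and averages against them\<close>

lemma has_bochner_integral_erlang_power:
  assumes "l > 0"
  shows "has_bochner_integral lborel (\<lambda>u. erlang_density k l u * u ^ i) (fact (k + i) / (fact k * l ^ i))"
proof (rule has_bochner_integral_nn_integral)
  show "AE u in lborel. 0 \<le> erlang_density k l u * u ^ i"
    using assms by (intro AE_I2) (auto simp: erlang_density_def)
  show "(\<integral>\<^sup>+ u. ennreal (erlang_density k l u * u ^ i) \<partial>lborel) = ennreal (fact (k + i) / (fact k * l ^ i))"
    using assms by (rule nn_integral_erlang_ith_moment)
qed (use assms in auto)

lemma has_bochner_integral_erlang_second_moment:
  fixes x :: real
  assumes "n \<ge> 1"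
  shows "has_bochner_integral lborel (\<lambda>u. erlang_density i (real n) u * (a + C * (u - x)\<^sup>2))
    (a + C * ((real i + 1) * (real i + 2) / (real n)\<^sup>2 - 2 * x * (real i + 1) / real n + x\<^sup>2))"
proof -
  have n: "real n > 0" using assms by simp
  have fact1: "fact (i + 1) = fact i * (real i + 1)"
    by (simp add: algebra_simps)
  have fact2: "fact (i + 2) = fact i * ((real i + 1) * (real i + 2))"
    by (simp add: numeral_2_eq_2 algebra_simps)
  note m = has_bochner_integral_erlang_power[OF n, of i]
  have "has_bochner_integral lborel (\<lambda>u. (a + C * x\<^sup>2) * (erlang_density i (real n) u * u ^ 0)
      + (- 2 * C * x) * (erlang_density i (real n) u * u ^ 1) + C * (erlang_density i (real n) u * u ^ 2))
    ((a + C * x\<^sup>2) * (fact (i + 0) / (fact i * real n ^ 0))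
      + (- 2 * C * x) * (fact (i + 1) / (fact i * real n ^ 1))
      + C * (fact (i + 2) / (fact i * real n ^ 2)))"
    by (intro has_bochner_integral_add has_bochner_integral_mult_right m)
  also have "(\<lambda>u. (a + C * x\<^sup>2) * (erlang_density i (real n) u * u ^ 0)
      + (- 2 * C * x) * (erlang_density i (real n) u * u ^ 1) + C * (erlang_density i (real n) u * u ^ 2))
      = (\<lambda>u. erlang_density i (real n) u * (a + C * (u - x)\<^sup>2))"
    by (simp add: fun_eq_iff algebra_simps power2_eq_square)
  also have "fact (i + 0) / (fact i * real n ^ 0) = 1"
    by simp
  also have "fact (i + 1) / (fact i * real n ^ 1) = (real i + 1) / real n"
    unfolding fact1 by simp
  also have "fact (i + 2) / (fact i * real n ^ 2) = (real i + 1) * (real i + 2) / (real n)\<^sup>2"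
    unfolding fact2 by simp
  finally show ?thesis
    by (simp add: algebra_simps)
qed

text \<open>On \<open>u \<ge> 0\<close>, \<open>n * exp (- n * u) * (n * u) ^ i / fact i\<close> is
  the Erlang density with parameters \<open>i\<close> and \<open>n\<close>. It has mass 1, so
  \<open>c\<close> may be moved under the integral, and the quadratic majorant yields both
  integrability and the estimate.\<close>

lemma erlang_average_bound:
  fixes f :: "real \<Rightarrow> real"
  assumes n: "n \<ge> 1" and cont: "continuous_on {0..} f"
    and bound: "\<And>u. u \<ge> 0 \<Longrightarrow> \<bar>f u - c\<bar> \<le> a + C * (u - x)\<^sup>2"
  shows "\<bar>real n * (LBINT u:{0..}. exp (- (real n * u)) * ((real n * u) ^ i / fact i) * f u) - c\<bar>
    \<le> a + C * ((real i + 1) * (real i + 2) / (real n)\<^sup>2 - 2 * x * (real i + 1) / real n + x\<^sup>2)"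
proof -
  let ?d = "erlang_density i (real n)"
  have N: "real n > 0" using n by simp
  note major = has_bochner_integral_erlang_second_moment[OF n, of i a C x]
  have one: "has_bochner_integral lborel ?d 1"
    using has_bochner_integral_erlang_second_moment[OF n, of i 1 0 0] by simp
  \<comment> \<open>Nothing is known about \<open>f\<close> on the negative axis, so measurability
    is shown for the function cut off there; the density vanishes at negative \<open>u\<close>,
    which makes the cut harmless.\<close>
  have meas: "(\<lambda>u. indicator {0..} u *\<^sub>R f u) \<in> borel_measurable borel"
    by (rule borel_measurable_continuous_on_indicator) (use cont in auto)
  have "(\<lambda>u. ?d u * (indicator {0..} u *\<^sub>R f u - c)) \<in> borel_measurable borel"
    by (intro borel_measurable_times borel_measurable_diff meas) auto
  also have "(\<lambda>u. ?d u * (indicator {0..} u *\<^sub>R f u - c)) = (\<lambda>u. ?d u * (f u - c))"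
    by (auto simp: fun_eq_iff erlang_density_def indicator_def)
  finally have meas': "(\<lambda>u. ?d u * (f u - c)) \<in> borel_measurable borel" .
  have le: "norm (?d u * (f u - c)) \<le> ?d u * (a + C * (u - x)\<^sup>2)" for u
    using bound[of u] N
    by (cases "u < 0") (auto simp: erlang_density_def abs_mult intro!: mult_left_mono divide_right_mono)
  have int: "integrable lborel (\<lambda>u. ?d u * (f u - c))"
  proof (rule Bochner_Integration.integrable_bound)
    show "integrable lborel (\<lambda>u. ?d u * (a + C * (u - x)\<^sup>2))"
      using major by (simp add: has_bochner_integral_iff)
    show "AE u in lborel. norm (?d u * (f u - c)) \<le> norm (?d u * (a + C * (u - x)\<^sup>2))"
      using le by (intro AE_I2) (metis real_norm_def abs_ge_self order.trans)
  qed (use meas' in simp)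
  have "real n * (LBINT u:{0..}. exp (- (real n * u)) * ((real n * u) ^ i / fact i) * f u) =
      (LBINT u. real n * (indicator {0..} u *\<^sub>R (exp (- (real n * u)) * ((real n * u) ^ i / fact i) * f u)))"
    by (simp add: set_lebesgue_integral_def)
  also have "\<dots> = (LBINT u. ?d u * (f u - c) + ?d u * c)"
    by (intro Bochner_Integration.integral_cong)
      (auto simp: erlang_density_def indicator_def power_mult_distrib field_simps)
  also have "\<dots> = (LBINT u. ?d u * (f u - c)) + c"
    using one int by (subst Bochner_Integration.integral_add) (auto simp: has_bochner_integral_iff)
  finally have "\<bar>real n * (LBINT u:{0..}. exp (- (real n * u)) * ((real n * u) ^ i / fact i) * f u) - c\<bar> =
      norm (LBINT u. ?d u * (f u - c))"
    by simp
  also have "\<dots> \<le> (LBINT u. ?d u * (a + C * (u - x)\<^sup>2))"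
    by (rule Bochner_Integration.integral_norm_bound_integral) (use int major le in \<open>auto simp: has_bochner_integral_iff\<close>)
  finally show ?thesis
    using major by (simp add: has_bochner_integral_iff)
qed

section \<open>From moments to an error bound for the operator\<close>

text \<open>The Erlang bounds are quadratic in \<open>i\<close>; summing them against the
  nonnegative weights of total mass 1 needs only the moments up to order two. The same majorant
  gives convergence of the series.\<close>

lemma U_op_bound:
  fixes f :: "real \<Rightarrow> real"
  assumes n: "n \<ge> 1" and \<alpha>: "\<alpha> \<ge> 0" and x: "x \<ge> 0" and cont: "continuous_on {0..} f"
    and bound: "\<And>u. u \<ge> 0 \<Longrightarrow> \<bar>f u - c\<bar> \<le> a + C * (u - x)\<^sup>2"
  shows "\<bar>U_op n \<alpha> f x - c\<bar> \<le> a + C * (\<alpha> * x + 2 * x / real n + 2 / (real n)\<^sup>2)"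
proof -
  define W where "W = weight_coeff n \<alpha> x"
  define J where "J i = (LBINT u:{0..}. exp (- (real n * u)) * ((real n * u) ^ i / fact i) * f u)" for i
  define q where "q i = a + C * ((real i + 1) * (real i + 2) / (real n)\<^sup>2 - 2 * x * (real i + 1) / real n + x\<^sup>2)" for i
  have N: "real n > 0" using n by simp
  have W0: "W i \<ge> 0" for i
    unfolding W_def using \<alpha> x by (rule weight_coeff_nonneg)
  have J: "\<bar>real n * J i - c\<bar> \<le> q i" for i
    unfolding J_def q_def using n cont bound by (rule erlang_average_bound)
  have W1: "W sums 1"
    unfolding W_def by (rule sums_weight_coeff[OF n \<alpha>])
  \<comment> \<open>The coefficients come from
    \<open>(i + 1) * (i + 2) = i * (i - 1) + 4 * i + 2\<close>, which writes \<open>q i\<close> in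
    terms of the known factorial moments.\<close>
  have "(\<lambda>i. C / (real n)\<^sup>2 * (real i * (real i - 1) * W i)
        + (4 * C / (real n)\<^sup>2 - 2 * C * x / real n) * (real i * W i)
        + (a + 2 * C / (real n)\<^sup>2 - 2 * C * x / real n + C * x\<^sup>2) * W i)
      sums (C / (real n)\<^sup>2 * ((real n)\<^sup>2 * x * (x + \<alpha>))
        + (4 * C / (real n)\<^sup>2 - 2 * C * x / real n) * (real n * x)
        + (a + 2 * C / (real n)\<^sup>2 - 2 * C * x / real n + C * x\<^sup>2) * 1)"
    unfolding W_def
    by (intro sums_add sums_mult sums_weight_coeff sums_weight_coeff_first_moment
        sums_weight_coeff_second_factorial_moment n \<alpha>)
  also have "(\<lambda>i. C / (real n)\<^sup>2 * (real i * (real i - 1) * W i)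
        + (4 * C / (real n)\<^sup>2 - 2 * C * x / real n) * (real i * W i)
        + (a + 2 * C / (real n)\<^sup>2 - 2 * C * x / real n + C * x\<^sup>2) * W i) = (\<lambda>i. W i * q i)"
    using N by (simp add: fun_eq_iff q_def field_simps power2_eq_square)
  \<comment> \<open>The terms in \<open>x\<^sup>2\<close> cancel, so the bound grows only linearly
    in \<open>x\<close>.\<close>
  also have "C / (real n)\<^sup>2 * ((real n)\<^sup>2 * x * (x + \<alpha>))
        + (4 * C / (real n)\<^sup>2 - 2 * C * x / real n) * (real n * x)
        + (a + 2 * C / (real n)\<^sup>2 - 2 * C * x / real n + C * x\<^sup>2) * 1
      = a + C * (\<alpha> * x + 2 * x / real n + 2 / (real n)\<^sup>2)"
    using N by (simp add: field_simps power2_eq_square)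
  finally have q: "(\<lambda>i. W i * q i) sums (a + C * (\<alpha> * x + 2 * x / real n + 2 / (real n)\<^sup>2))" .
  have le: "norm (W i * (real n * J i - c)) \<le> W i * q i" for i
    using W0[of i] J[of i] by (simp add: abs_mult mult_left_mono)
  have s: "summable (\<lambda>i. W i * (real n * J i - c))"
    using sums_summable[OF q] le by (rule summable_comparison_test')
  have "(\<lambda>i. inverse (real n) * (W i * (real n * J i - c) + c * W i)) sums
      (inverse (real n) * ((\<Sum>i. W i * (real n * J i - c)) + c * 1))"
    by (intro sums_mult sums_add summable_sums s W1)
  also have "(\<lambda>i. inverse (real n) * (W i * (real n * J i - c) + c * W i)) = (\<lambda>i. W i * J i)"
    using N by (simp add: fun_eq_iff field_simps)
  finally have "(\<Sum>i. W i * J i) = inverse (real n) * ((\<Sum>i. W i * (real n * J i - c)) + c * 1)"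
    by (rule sums_unique[symmetric])
  moreover have "U_op n \<alpha> f x = real n * (\<Sum>i. W i * J i)"
    unfolding U_op_def W_def J_def ..
  ultimately have "U_op n \<alpha> f x = (\<Sum>i. W i * (real n * J i - c)) + c"
    using N by simp
  then have "\<bar>U_op n \<alpha> f x - c\<bar> = norm (\<Sum>i. W i * (real n * J i - c))"
    by simp
  also have "\<dots> \<le> (\<Sum>i. W i * q i)"
    using le sums_summable[OF q] by (rule norm_suminf_le)
  finally show ?thesis
    unfolding sums_unique[OF q, symmetric] .
qed

section \<open>Error bounds from the quadratic growth condition\<close>

lemma moment_le:
  assumes "n \<ge> 1" "\<alpha> \<le> 1 / real n" "x \<ge> 0"
  shows "\<alpha> * x + 2 * x / real n + 2 / (real n)\<^sup>2 \<le> (3 * x + 2) / real n"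
proof -
  have "\<alpha> * x \<le> 1 / real n * x"
    using assms by (intro mult_right_mono) auto
  moreover have "2 / (real n)\<^sup>2 \<le> 2 / real n"
    using assms by (intro divide_left_mono) (auto simp: power2_eq_square)
  ultimately show ?thesis
    by (simp add: add_divide_distrib)
qed

lemma B_w_diff_le:
  assumes "\<And>x. x \<ge> 0 \<Longrightarrow> \<bar>f x\<bar> \<le> M * w x" "M > 0" "u \<ge> 0" "x \<ge> 0"
  shows "\<bar>f u - f x\<bar> \<le> M * (2 + 3 * x\<^sup>2) + 2 * M * (u - x)\<^sup>2"
proof -
  have "\<bar>f u - f x\<bar> \<le> M * w u + M * w x"
    using assms(1)[of u] assms(1)[of x] assms(3,4) by linarith
  also have "\<dots> = M * (w u + w x)"
    by (simp add: distrib_left)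
  also have "\<dots> \<le> M * (2 + 3 * x\<^sup>2 + 2 * (u - x)\<^sup>2)"
    \<comment> \<open>Expanding \<open>(u - 2 * x)\<^sup>2 \<ge> 0\<close> gives
      \<open>u\<^sup>2 \<le> 2 * x\<^sup>2 + 2 * (u - x)\<^sup>2\<close>.\<close>
    using assms(2) sum_squares_ge_zero[of "u - 2 * x" 0]
    by (intro mult_left_mono) (auto simp: w_def power2_eq_square algebra_simps)
  finally show ?thesis
    by (simp add: algebra_simps)
qed

text \<open>A crude bound, uniform in \<open>n\<close> and \<open>\<alpha>\<close>, for large
  \<open>x\<close>: no smallness is sought here, since the extra power \<open>l\<close> of the
  weight supplies it later.\<close>

lemma U_op_tail_bound:
  assumes M: "\<And>x. x \<ge> 0 \<Longrightarrow> \<bar>f x\<bar> \<le> M * w x" "M > 0" and cont: "continuous_on {0..} f"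
    and n: "n \<ge> 1" and \<alpha>: "0 \<le> \<alpha>" "\<alpha> \<le> 1 / real n" and x: "x \<ge> 0"
  shows "\<bar>U_op n \<alpha> f x - f x\<bar> \<le> 9 * M * (1 + x\<^sup>2)"
proof -
  have "\<bar>U_op n \<alpha> f x - f x\<bar> \<le> M * (2 + 3 * x\<^sup>2) + 2 * M * (\<alpha> * x + 2 * x / real n + 2 / (real n)\<^sup>2)"
    by (intro U_op_bound n \<alpha> x cont B_w_diff_le M)
  also have "\<dots> \<le> M * (2 + 3 * x\<^sup>2) + 2 * M * ((3 * x + 2) / real n)"
    using M(2) by (intro add_left_mono mult_left_mono moment_le n \<alpha> x) auto
  also have "\<dots> \<le> M * (2 + 3 * x\<^sup>2) + 2 * M * (3 * x + 2)"
    using M(2) n x divide_left_mono[of 1 "real n" "3 * x + 2"] by (intro add_left_mono mult_left_mono) auto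
  also have "\<dots> = M * (6 + 3 * x\<^sup>2 + 6 * x)"
    by (simp add: algebra_simps)
  also have "6 + 3 * x\<^sup>2 + 6 * x \<le> 9 * (1 + x\<^sup>2)"
    using zero_le_power2[of "x - 1"] zero_le_power2[of x]
    unfolding power2_diff power_one distrib_left by linarith
  finally show ?thesis
    using M(2) by (simp add: algebra_simps)
qed

text \<open>Close to \<open>x\<close> uniform continuity gives \<open>e\<close>. At distance at
  least \<open>r\<close> the factor \<open>(u - x)\<^sup>2 / r\<^sup>2\<close> is at least 1 and
  absorbs the constant of the growth bound. The point is that one \<open>C\<close> serves all
  \<open>x\<close> in \<open>[0, A]\<close>.\<close>

lemma B_w_local_bound:
  assumes M: "\<And>x. x \<ge> 0 \<Longrightarrow> \<bar>f x\<bar> \<le> M * w x" "M > 0" and cont: "continuous_on {0..} f"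
    and e: "e > 0" and A: "A \<ge> 0"
  obtains C where "C \<ge> 0"
    "\<And>u x. 0 \<le> x \<Longrightarrow> x \<le> A \<Longrightarrow> 0 \<le> u \<Longrightarrow> \<bar>f u - f x\<bar> \<le> e + C * (u - x)\<^sup>2"
proof -
  have "uniformly_continuous_on {0..A + 1} f"
    \<comment> \<open>The interval reaches to \<open>A + 1\<close> so that it contains every
      \<open>u \<ge> 0\<close> within \<open>r \<le> 1\<close> of a point of
      \<open>[0, A]\<close>.\<close>
    by (intro compact_uniformly_continuous continuous_on_subset[OF cont]) auto
  then obtain d where d: "d > 0"
    "\<And>x u. x \<in> {0..A + 1} \<Longrightarrow> u \<in> {0..A + 1} \<Longrightarrow> dist u x < d \<Longrightarrow> dist (f u) (f x) < e"
    unfolding uniformly_continuous_on_def using e by metis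
  define r where "r = min d 1"
  define C where "C = M * (2 + 3 * A\<^sup>2) / r\<^sup>2 + 2 * M"
  have r: "0 < r" "r \<le> d" "r \<le> 1"
    using d by (auto simp: r_def)
  have C: "C \<ge> 0"
    using M(2) by (auto simp: C_def)
  moreover have "\<bar>f u - f x\<bar> \<le> e + C * (u - x)\<^sup>2" if x: "0 \<le> x" "x \<le> A" and u: "0 \<le> u" for u x
  proof (cases "\<bar>u - x\<bar> < r")
    case True
    then have "dist (f u) (f x) < e"
      using x u r by (intro d) (auto simp: dist_real_def)
    then show ?thesis
      using mult_nonneg_nonneg[OF C zero_le_power2[of "u - x"]] by (simp add: dist_real_def)
  next
    case False
    have "r\<^sup>2 \<le> (u - x)\<^sup>2"
      using False r by (simp add: abs_le_square_iff[symmetric])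
    then have 1: "1 \<le> (u - x)\<^sup>2 / r\<^sup>2"
      using r by simp
    have "\<bar>f u - f x\<bar> \<le> M * (2 + 3 * x\<^sup>2) + 2 * M * (u - x)\<^sup>2"
      using M u x(1) by (rule B_w_diff_le)
    also have "M * (2 + 3 * x\<^sup>2) \<le> M * (2 + 3 * A\<^sup>2)"
      using M(2) x by (auto intro: power_mono)
    also have "\<dots> \<le> M * (2 + 3 * A\<^sup>2) * ((u - x)\<^sup>2 / r\<^sup>2)"
      using M(2) mult_left_mono[OF 1, of "M * (2 + 3 * A\<^sup>2)"] by simp
    finally show ?thesis
      using e by (simp add: C_def algebra_simps add_divide_distrib)
  qed
  ultimately show ?thesis
    by (rule that)
qed

section \<open>Weighted uniform convergence\<close>

lemma eventually_U_op_quotient_le: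
  assumes \<alpha>: "\<And>n. n \<ge> 1 \<Longrightarrow> 0 \<le> \<alpha> n \<and> \<alpha> n \<le> 1 / real n"
    and g: "g \<in> C_w" and l: "l > 0" and e: "e > 0"
  shows "\<forall>\<^sub>F n in sequentially. \<forall>x\<ge>0. \<bar>U_op n (\<alpha> n) g x - g x\<bar> / (1 + x\<^sup>2) powr (1 + l) \<le> e"
proof -
  obtain M where M: "M > 0" "\<And>x. x \<ge> 0 \<Longrightarrow> \<bar>g x\<bar> \<le> M * w x"
    using g by (auto simp: C_w_def B_w_def)
  have cont: "continuous_on {0..} g"
    using g by (simp add: C_w_def)
  \<comment> \<open>Past \<open>A\<close> the tail bound divided by the weight is at most
    \<open>9 * M / (1 + A\<^sup>2) powr l\<close>, so \<open>A\<close> is chosen to push this below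
    \<open>e\<close>, independently of \<open>n\<close>.\<close>
  have "((\<lambda>A::real. 9 * M / (1 + A\<^sup>2) powr l) \<longlongrightarrow> 0) at_top"
    using l by real_asymp
  then have "\<forall>\<^sub>F A in at_top. 9 * M / (1 + A\<^sup>2) powr l < e"
    by (rule order_tendstoD) (rule e)
  then have "\<forall>\<^sub>F A in at_top. 9 * M / (1 + A\<^sup>2) powr l < e \<and> A \<ge> 0"
    by (intro eventually_conj eventually_ge_at_top)
  then obtain A where A: "9 * M / (1 + A\<^sup>2) powr l < e" "A \<ge> 0"
    by (auto simp: eventually_at_top_linorder)
  obtain C where C: "C \<ge> 0"
    \<comment> \<open>Half of \<open>e\<close> is spent on continuity; the other half is left for
      the moment term, estimated at \<open>x = A\<close> so that one threshold for \<open>n\<close>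
      works on all of \<open>[0, A]\<close>.\<close>
    "\<And>u x. 0 \<le> x \<Longrightarrow> x \<le> A \<Longrightarrow> 0 \<le> u \<Longrightarrow> \<bar>g u - g x\<bar> \<le> e / 2 + C * (u - x)\<^sup>2"
    using B_w_local_bound[OF M(2,1) cont half_gt_zero[OF e] A(2)] by metis
  have "(\<lambda>n. C * ((3 * A + 2) / real n)) \<longlonglongrightarrow> 0"
    by real_asymp
  then have "\<forall>\<^sub>F n in sequentially. C * ((3 * A + 2) / real n) < e / 2"
    by (rule order_tendstoD) (use e in simp)
  then show ?thesis
    using eventually_ge_at_top[of 1]
  proof eventually_elim
    case (elim n)
    have \<alpha>n: "0 \<le> \<alpha> n" "\<alpha> n \<le> 1 / real n"
      using \<alpha> elim by auto
    show ?case
    proof (intro allI impI)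
      fix x :: real
      assume x: "x \<ge> 0"
      define P where "P = (1 + x\<^sup>2) powr (1 + l)"
      have x1: "1 + x\<^sup>2 \<ge> 1" by simp
      have P: "P = (1 + x\<^sup>2) * (1 + x\<^sup>2) powr l"
        using x1 by (simp add: P_def powr_add)
      have P1: "P \<ge> 1"
        unfolding P_def using x1 l by (intro ge_one_powr_ge_zero) auto
      have "\<bar>U_op n (\<alpha> n) g x - g x\<bar> \<le> e * P"
      proof (cases "x \<le> A")
        case True
        have "\<bar>U_op n (\<alpha> n) g x - g x\<bar> \<le> e / 2 + C * (\<alpha> n * x + 2 * x / real n + 2 / (real n)\<^sup>2)"
          by (intro U_op_bound elim \<alpha>n x cont C True)
        also have "\<dots> \<le> e / 2 + C * ((3 * x + 2) / real n)"
          using C(1) by (intro add_left_mono mult_left_mono moment_le elim \<alpha>n x) auto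
        also have "\<dots> \<le> e / 2 + C * ((3 * A + 2) / real n)"
          using C(1) True by (intro add_left_mono mult_left_mono divide_right_mono) auto
        also have "\<dots> \<le> e * 1"
          using elim by linarith
        also have "\<dots> \<le> e * P"
          using e P1 by (intro mult_left_mono) auto
        finally show ?thesis .
      next
        case False
        have pos: "(1 + A\<^sup>2) powr l > 0"
          using sum_power2_gt_zero_iff[of 1 A] by simp
        have "\<bar>U_op n (\<alpha> n) g x - g x\<bar> \<le> 9 * M * (1 + x\<^sup>2)"
          by (intro U_op_tail_bound M cont elim \<alpha>n x)
        also have "\<dots> \<le> (e * (1 + A\<^sup>2) powr l) * (1 + x\<^sup>2)"
          using A(1) pos by (intro mult_right_mono) (auto simp: field_simps)
        also have "\<dots> \<le> (e * (1 + x\<^sup>2) powr l) * (1 + x\<^sup>2)"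
          using e l A(2) False by (intro mult_right_mono mult_left_mono powr_mono2) (auto intro: power_mono)
        finally show ?thesis
          by (simp add: P mult_ac)
      qed
      then show "\<bar>U_op n (\<alpha> n) g x - g x\<bar> / (1 + x\<^sup>2) powr (1 + l) \<le> e"
        using P1 by (simp add: P_def[symmetric] divide_le_eq)
    qed
  qed
qed

theorem theorem4p2:
  fixes \<alpha> :: "nat \<Rightarrow> real" and g :: "real \<Rightarrow> real" and l :: real
  assumes "\<And>n. n \<ge> 1 \<Longrightarrow> 0 \<le> \<alpha> n \<and> \<alpha> n \<le> 1 / real n"
    and "g \<in> C_w_k"
    and "l > 0"
  shows "(\<lambda>n. SUP x\<in>{0..}. ereal (\<bar>U_op n (\<alpha> n) g x - g x\<bar> / (1 + x\<^sup>2) powr (1 + l)))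
           \<longlonglongrightarrow> 0"
proof (rule order_tendstoI)
  fix a :: ereal
  assume "a < 0"
  then show "\<forall>\<^sub>F n in sequentially.
      a < (SUP x\<in>{0..}. ereal (\<bar>U_op n (\<alpha> n) g x - g x\<bar> / (1 + x\<^sup>2) powr (1 + l)))"
    \<comment> \<open>The quotient at \<open>x = 0\<close> is nonnegative, hence so is the
      supremum.\<close>
    by (intro always_eventually allI) (rule less_le_trans[OF _ SUP_upper2[of 0]], auto)
next
  fix a :: ereal
  assume "0 < a"
  \<comment> \<open>A real \<open>e\<close> strictly between is needed: \<open>a\<close> may be
    infinite, and the supremum of terms at most \<open>e\<close> is only known to be at most
    \<open>e\<close>.\<close>
  then obtain e where e: "0 < ereal e" "ereal e < a"
    using ereal_dense2 by blast
  have "g \<in> C_w"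
    using assms(2) by (simp add: C_w_k_def)
  then have "\<forall>\<^sub>F n in sequentially. \<forall>x\<ge>0. \<bar>U_op n (\<alpha> n) g x - g x\<bar> / (1 + x\<^sup>2) powr (1 + l) \<le> e"
    using assms(1,3) e(1) by (intro eventually_U_op_quotient_le) auto
  then show "\<forall>\<^sub>F n in sequentially.
      (SUP x\<in>{0..}. ereal (\<bar>U_op n (\<alpha> n) g x - g x\<bar> / (1 + x\<^sup>2) powr (1 + l))) < a"
  proof eventually_elim
    case (elim n)
    then have "(SUP x\<in>{0..}. ereal (\<bar>U_op n (\<alpha> n) g x - g x\<bar> / (1 + x\<^sup>2) powr (1 + l))) \<le> ereal e"
      by (intro SUP_least) auto
    also note e(2)
    finally show ?case .
  qed
qed

end
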